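(* Let $m,n,t,r$ be positive integers with $m\ge 2$, $n\ge 2t-r-(m-2)$, and $2t-r>m-1$. Let $G_{m,n}$ be the grid graph with $m$ rows and $n$ columns. Then \[\gamma_{t,r}(G_{m,n})\le 2+\left\lceil \frac{n-(2t-r-(m-2))}{(2t-r-(m-2))-1}\right\rceil .\]
   Context: $G_{m,n}$ is the graph whose vertices are the integer points of an $m\times n$ rectangular array, with two vertices adjacent exactly when they are at Euclidean distance $1$. For a connected graph $G$ with vertex set $V(G)$ and graph distance $d$, positive integers $t,r$, and a set $\mathbb T\subseteq V(G)$ (whose elements are called towers, of strength $t$), the signal received by $v\in V(G)$ is $f(v)=\sum_{w\in\mathbb T}\max\{0,\,t-d(v,w)\}$ (a tower also receives its own signal). The set $\mathbb T$ is a $(t,r)$ broadcast dominating set if $f(v)\ge r$ for every $v\in V(G)$. The $(t,r)$ broadcast domination number $\gamma_{t,r}(G)$ is the minimum cardinality of a $(t,r)$ broadcast dominating set of $G$. *)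

theory Defs
  imports "HOL-Analysis.Product_Vector" "Graph_Theory.Graph_Theory"
begin

context graph
begin

text \<open>With unit arc weights, \<open>\<mu>\<close> is the usual graph distance, as an extended real.  It is infinite
  exactly when there is no walk, in which case a tower contributes no signal.\<close>

definition graph_dist :: "'a \<Rightarrow> 'a \<Rightarrow> ereal" where
  "graph_dist v w = \<mu> (\<lambda>_. 1) v w"

definition signal :: "nat \<Rightarrow> 'a set \<Rightarrow> 'a \<Rightarrow> ereal" where
  "signal t T v = (\<Sum>w\<in>T. max 0 (ereal (real t) - graph_dist v w))"

definition broadcast_dominating_set :: "nat \<Rightarrow> nat \<Rightarrow> 'a set \<Rightarrow> bool" where
  "broadcast_dominating_set t r T \<longleftrightarrow>
     T \<subseteq> verts G \<and> (\<forall>v\<in>verts G. signal t T v \<ge> ereal (real r))"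

text \<open>If there is no dominating set, \<open>LEAST\<close> is an unspecified number, so an upper bound
  for this quantity is provable only where dominating sets exist.\<close>

definition broadcast_domination_number :: "nat \<Rightarrow> nat \<Rightarrow> nat" where
  "broadcast_domination_number t r =
     (LEAST k. \<exists>T. broadcast_dominating_set t r T \<and> card T = k)"

end

text \<open>The grid with \<open>m\<close> rows and \<open>n\<close> columns; the vertex \<open>(i, j)\<close> lies in row \<open>i\<close> and column \<open>j\<close>.
  The metric on \<open>real \<times> real\<close> is the Euclidean one.\<close>

definition grid_graph :: "nat \<Rightarrow> nat \<Rightarrow> (int \<times> int, (int \<times> int) \<times> (int \<times> int)) pre_digraph" where
  "grid_graph m n =
     (let V = {1..int m} \<times> {1..int n}
      in with_proj \<lparr> pverts = V,
           parcs = {(u, v) \<in> V \<times> V.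
             dist (map_prod real_of_int real_of_int u) (map_prod real_of_int real_of_int v) = 1} \<rparr>)"

text \<open>Hence the notions of the locale \<open>graph\<close> apply to grids.\<close>

lemma graph_grid_graph: "graph (grid_graph m n)"
proof -
  let ?V = "{1..int m} \<times> {1..int n}"
  let ?A = "{(u, v) \<in> ?V \<times> ?V.
    dist (map_prod real_of_int real_of_int u) (map_prod real_of_int real_of_int v) = 1}"
  have fin: "finite ?A"
    by (rule finite_subset[of _ "?V \<times> ?V"]) auto
  have sym: "sym ?A"
    by (auto simp: sym_def dist_commute)
  have sel: "verts (grid_graph m n) = ?V" "arcs (grid_graph m n) = ?A"
    "tail (grid_graph m n) = fst" "head (grid_graph m n) = snd"
    by (simp_all add: grid_graph_def Let_def)
  have "arcs_ends (grid_graph m n) = ?A"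
    by (simp add: arcs_ends_conv sel)
  with sym have "symmetric (grid_graph m n)"
    by (simp add: symmetric_def)
  with fin show ?thesis
    by unfold_locales (auto simp: sel arc_to_ends_def)
qed

end

(* Put towers in the columns 1, 1 + D, 1 + 2 D, ... and n, where D = 2 t - r - (m - 1), alternating
   between the first and the last row.  A vertex in a column between two consecutive towers has
   distances to them that add up to at most (m - 1) + D = 2 t - r, so these two towers alone send
   it a signal of at least r.  The number of towers is 1 + \<lceil>(n - 1) / D\<rceil>. *)

theory Submission
  imports Defs
begin

lemma verts_grid_graph [simp]: "verts (grid_graph m n) = {1..int m} \<times> {1..int n}"
  and tail_grid_graph [simp]: "tail (grid_graph m n) = fst"
  and head_grid_graph [simp]: "head (grid_graph m n) = snd"
  by (simp_all add: grid_graph_def Let_def)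

lemma arcs_grid_graph_row:
  assumes "(i, j) \<in> verts (grid_graph m n)" "(i', j) \<in> verts (grid_graph m n)" "\<bar>i - i'\<bar> = 1"
  shows "((i, j), (i', j)) \<in> arcs (grid_graph m n)"
proof -
  have "\<bar>real_of_int i - real_of_int i'\<bar> = 1"
    using assms(3) by linarith
  with assms(1,2) show ?thesis
    by (simp add: grid_graph_def Let_def dist_Pair_Pair dist_real_def)
qed

lemma arcs_grid_graph_column:
  assumes "(i, j) \<in> verts (grid_graph m n)" "(i, j') \<in> verts (grid_graph m n)" "\<bar>j - j'\<bar> = 1"
  shows "((i, j), (i, j')) \<in> arcs (grid_graph m n)"
proof -
  have "\<bar>real_of_int j - real_of_int j'\<bar> = 1"
    using assms(3) by linarith
  with assms(1,2) show ?thesis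
    by (simp add: grid_graph_def Let_def dist_Pair_Pair dist_real_def)
qed

text \<open>Each step moves one unit towards the target, first in the row index until it agrees,
  then in the column index. The next vertex lies between the current one and the target, hence
  inside the rectangle.\<close>

lemma grid_graph_awalk:
  assumes "(i, j) \<in> verts (grid_graph m n)" "(i', j') \<in> verts (grid_graph m n)"
    and "\<bar>i - i'\<bar> + \<bar>j - j'\<bar> = int k"
  shows "\<exists>p. pre_digraph.awalk (grid_graph m n) (i, j) p (i', j') \<and> length p = k"
  using assms
proof (induction k arbitrary: i j)
  case 0
  interpret graph "grid_graph m n" by (rule graph_grid_graph)
  from 0(3) have "i = i'" "j = j'" by linarith+
  with 0(1) have "awalk (i, j) [] (i', j')"
    by (simp add: awalk_Nil_iff)
  then show ?case by auto
next
  case (Suc k)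
  interpret graph "grid_graph m n" by (rule graph_grid_graph)
  obtain i1 j1 where step: "(i1, j1) \<in> verts (grid_graph m n)"
      "((i, j), (i1, j1)) \<in> arcs (grid_graph m n)" "\<bar>i1 - i'\<bar> + \<bar>j1 - j'\<bar> = int k"
  proof (cases "i = i'")
    case True
    let ?j = "if j < j' then j + 1 else j - 1"
    have "(i, ?j) \<in> verts (grid_graph m n)" "\<bar>i - i'\<bar> + \<bar>?j - j'\<bar> = int k"
      using True Suc.prems by auto
    with Suc.prems(1) that[of i ?j] show ?thesis
      by (simp add: arcs_grid_graph_column)
  next
    case False
    let ?i = "if i < i' then i + 1 else i - 1"
    have "(?i, j) \<in> verts (grid_graph m n)" "\<bar>?i - i'\<bar> + \<bar>j - j'\<bar> = int k"
      using False Suc.prems by auto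
    with Suc.prems(1) that[of ?i j] show ?thesis
      by (simp add: arcs_grid_graph_row)
  qed
  from Suc.IH[OF step(1) Suc.prems(2) step(3)]
  obtain p where "awalk (i1, j1) p (i', j')" "length p = k" by blast
  with step(2) have "awalk (i, j) (((i, j), (i1, j1)) # p) (i', j')"
    "length (((i, j), (i1, j1)) # p) = Suc k"
    by (simp_all add: awalk_Cons_iff)
  then show ?case by blast
qed

text \<open>The cost of the walk just constructed bounds the distance. An upper bound suffices,
  since a smaller distance only strengthens a signal.\<close>

lemma graph_dist_grid_graph_le:
  assumes "(i, j) \<in> verts (grid_graph m n)" "(i', j') \<in> verts (grid_graph m n)"
  shows "graph.graph_dist (grid_graph m n) (i, j) (i', j')
    \<le> ereal (of_int (\<bar>i - i'\<bar> + \<bar>j - j'\<bar>))"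
proof -
  interpret graph "grid_graph m n" by (rule graph_grid_graph)
  define k where "k = nat (\<bar>i - i'\<bar> + \<bar>j - j'\<bar>)"
  have k: "\<bar>i - i'\<bar> + \<bar>j - j'\<bar> = int k"
    by (simp add: k_def)
  obtain p where p: "awalk (i, j) p (i', j')" "length p = k"
    using grid_graph_awalk[OF assms k] by blast
  have "awalk_cost (\<lambda>_. 1) p = real k"
    using p(2) by (simp add: awalk_cost_def sum_list_triv)
  then show ?thesis
    using min_cost_le_walk_cost[OF p(1), of "\<lambda>_. 1"] k by (simp add: graph_dist_def)
qed

text \<open>The two towers contribute at least \<open>t - a\<close> and \<open>t - b\<close>, even
  when one of these is negative, because of the \<open>max\<close> with 0. All other contributions
  are nonnegative. The towers must be distinct, as \<open>signal\<close> sums over a set.\<close>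

lemma (in graph) signal_ge_two_towers:
  assumes "finite T" "w1 \<in> T" "w2 \<in> T" "w1 \<noteq> w2"
    and "graph_dist v w1 \<le> ereal a" "graph_dist v w2 \<le> ereal b" "a + b \<le> 2 * real t - real r"
  shows "ereal (real r) \<le> signal t T v"
proof -
  let ?f = "\<lambda>w. max 0 (ereal (real t) - graph_dist v w)"
  have "ereal (real t - a) \<le> ?f w1" "ereal (real t - b) \<le> ?f w2"
    using ereal_minus_mono[OF order_refl assms(5), of "ereal (real t)"]
      ereal_minus_mono[OF order_refl assms(6), of "ereal (real t)"] by (simp_all add: max.coboundedI2)
  then have "ereal (real t - a) + ereal (real t - b) \<le> ?f w1 + ?f w2"
    by (rule add_mono)
  moreover have "ereal (real r) \<le> ereal (real t - a) + ereal (real t - b)"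
    using assms(7) by simp
  moreover have "?f w1 + ?f w2 = sum ?f {w1, w2}"
    using assms(4) by simp
  moreover have "sum ?f {w1, w2} \<le> sum ?f T"
    using assms(1-3) by (intro sum_mono2) auto
  ultimately show ?thesis
    unfolding signal_def by (metis order_trans)
qed

lemma (in graph) broadcast_domination_number_le:
  assumes "broadcast_dominating_set t r T"
  shows "broadcast_domination_number t r \<le> card T"
  unfolding broadcast_domination_number_def using assms by (intro Least_le) blast

lemma arithmetic_progression_bracket:
  fixes a d x :: int
  assumes "a \<le> x" "x \<le> a + int K * d" "K > 0"
  shows "\<exists>k<K. a + int k * d \<le> x \<and> x \<le> a + int (Suc k) * d"
  using assms
proof (induction K)
  case (Suc K)
  show ?case
  proof (cases "K > 0 \<and> x \<le> a + int K * d")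
    case True
    with Suc show ?thesis by (meson less_SucI)
  next
    case False
    \<comment> \<open>For \<open>K = 0\<close> the last interval starts at \<open>a\<close> itself;
      otherwise \<open>x\<close> lies beyond its left end.\<close>
    with Suc.prems have "a + int K * d \<le> x" by (cases "K = 0") auto
    with Suc.prems(2) show ?thesis by blast
  qed
qed simp

text \<open>Here \<open>K\<close> counts the gaps between consecutive towers, so there are at most
  \<open>K + 1\<close> towers.\<close>

lemma broadcast_domination_number_grid_graph_le:
  fixes m n t r K :: nat and D :: int
  assumes "m \<ge> 2" "n > 0" "K > 0" "D \<ge> 0"
    and D: "int m - 1 + D \<le> 2 * int t - int r"
    and K: "int n \<le> 1 + int K * D"
  shows "graph.broadcast_domination_number (grid_graph m n) t r \<le> Suc K"
proof -
  interpret graph "grid_graph m n" by (rule graph_grid_graph)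
  define row where "row k = (if even k then 1 else int m)" for k :: nat
  \<comment> \<open>The minimum pulls towers that would overshoot the grid back to column
    \<open>n\<close>.\<close>
  define col where "col k = min (int n) (1 + int k * D)" for k :: nat
  define tower where "tower k = (row k, col k)" for k
  define T where "T = tower ` {..K}"
  have fin: "finite T"
    by (simp add: T_def)
  have tower_vert: "tower k \<in> verts (grid_graph m n)" for k
    using assms by (simp add: tower_def row_def col_def)
  have "broadcast_dominating_set t r T"
    unfolding broadcast_dominating_set_def
  proof (intro conjI ballI)
    show "T \<subseteq> verts (grid_graph m n)"
      unfolding T_def using tower_vert by blast
    fix v assume v: "v \<in> verts (grid_graph m n)"
    obtain i j where ij: "v = (i, j)" by fastforce
    with v have bounds: "1 \<le> i" "i \<le> int m" "1 \<le> j" "j \<le> int n" by auto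
    obtain k where k: "k < K" "1 + int k * D \<le> j" "j \<le> 1 + int (Suc k) * D"
      using arithmetic_progression_bracket[of 1 j K D] bounds K assms(3) by auto
    let ?d = "\<lambda>k. \<bar>i - row k\<bar> + \<bar>j - col k\<bar>"
    \<comment> \<open>Consecutive towers occupy opposite border rows, and row \<open>i\<close> lies
      between them.\<close>
    have rows: "\<bar>i - row k\<bar> + \<bar>i - row (Suc k)\<bar> = int m - 1"
      using bounds by (auto simp: row_def)
    \<comment> \<open>Capping at \<open>n\<close> is harmless: \<open>j\<close> is at most
      \<open>n\<close>, and gaps can only shrink.\<close>
    have "col k \<le> j" "j \<le> col (Suc k)" "col (Suc k) \<le> col k + D"
      using k bounds assms(4) by (auto simp: col_def algebra_simps)
    with rows D have "?d k + ?d (Suc k) \<le> 2 * int t - int r"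
      by linarith
    then have sum: "real_of_int (?d k) + real_of_int (?d (Suc k)) \<le> 2 * real t - real r"
      by linarith
    have dist: "graph_dist v (tower k) \<le> ereal (of_int (?d k))" for k
      using graph_dist_grid_graph_le[of i j m n "row k" "col k"] v tower_vert[of k]
      unfolding ij tower_def by blast
    \<comment> \<open>Even if the columns coincide, the rows 1 and \<open>m\<close> differ.\<close>
    have "tower k \<noteq> tower (Suc k)"
      using assms(1) by (auto simp: tower_def row_def)
    then show "ereal (real r) \<le> signal t T v"
      using k(1) by (intro signal_ge_two_towers[OF fin _ _ _ dist dist sum]) (auto simp: T_def)
  qed
  then have "broadcast_domination_number t r \<le> card T"
    by (rule broadcast_domination_number_le)
  also have "card T \<le> Suc K"
    unfolding T_def using card_image_le[of "{..K}" tower] by simp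
  finally show ?thesis .
qed

theorem theorem1p2:
  fixes m n t r :: nat
  assumes "m > 0" "n > 0" "t > 0" "r > 0"
    and "m \<ge> 2"
    and "int n \<ge> 2 * int t - int r - (int m - 2)"
    and "2 * int t - int r > int m - 1"
  shows "int (graph.broadcast_domination_number (grid_graph m n) t r) \<le>
    2 + \<lceil>(real n - (2 * real t - real r - (real m - 2))) /
         ((2 * real t - real r - (real m - 2)) - 1)\<rceil>"
proof -
  \<comment> \<open>This spacing is the denominator of the claimed bound, and
    \<open>n - 1 - D\<close> is its numerator.\<close>
  define D where "D = 2 * int t - int r - (int m - 1)"
  define q where "q = \<lceil>real_of_int (int n - 1 - D) / real_of_int D\<rceil>"
  have D: "D > 0" and nD: "int n - 1 - D \<ge> 0"
    using assms(6,7) by (auto simp: D_def)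
  \<comment> \<open>Nonnegativity ensures that \<open>nat q\<close> does not truncate.\<close>
  have "q \<ge> 0"
    using divide_nonneg_pos[of "real_of_int (int n - 1 - D)" "real_of_int D"] D nD
    unfolding q_def by linarith
  have "real_of_int (int n - 1 - D) / real_of_int D \<le> real_of_int q"
    unfolding q_def by (rule le_of_int_ceiling)
  then have "real_of_int (int n - 1 - D) \<le> real_of_int (q * D)"
    using D by (simp add: pos_divide_le_eq)
  then have "int n - 1 - D \<le> q * D"
    by (simp only: of_int_le_iff)
  \<comment> \<open>Take \<open>q + 1\<close> gaps: \<open>q\<close> of them cover
    \<open>n - 1 - D\<close> and one more covers the remaining \<open>D\<close>. This gives
    \<open>q + 2\<close> towers.\<close>
  then have "int n \<le> 1 + int (Suc (nat q)) * D"
    using \<open>q \<ge> 0\<close> by (simp add: algebra_simps)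
  then have "graph.broadcast_domination_number (grid_graph m n) t r \<le> Suc (Suc (nat q))"
    using assms D by (intro broadcast_domination_number_grid_graph_le[where D = D]) (auto simp: D_def)
  then have "int (graph.broadcast_domination_number (grid_graph m n) t r) \<le> 2 + q"
    using \<open>q \<ge> 0\<close> by linarith
  also have "q = \<lceil>(real n - (2 * real t - real r - (real m - 2))) /
         ((2 * real t - real r - (real m - 2)) - 1)\<rceil>"
    by (simp add: q_def D_def algebra_simps)
  finally show ?thesis .
qed

end
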